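(* Let $f_1:[a,b]\to\mathbb{R}$ ($a<b$) be an increasing polynomial of degree $m\ge 1$, and let $B_n^{f_1}$ be the generalized Bernstein operator over $[a,b]$ fixing $f_1$ and the constant function $\mathbf{1}$ (which exists for all sufficiently large $n$). Then for all $f\in C[a,b]$, $$\lim_{n\to\infty}\left\|B_n^{f_1}f-f\right\|_\infty=0.$$
   Context: $\mathbb{P}_n[a,b]$ is the space of real polynomials of degree at most $n$ on $[a,b]$, with the standard Bernstein basis $p_{n,k}(x)=\binom{n}{k}\frac{(x-a)^k(b-x)^{n-k}}{(b-a)^n}$, $k=0,\dots,n$. A generalized Bernstein operator $C[a,b]\to\mathbb{P}_n[a,b]$ is an operator of the form $f\mapsto\sum_{k=0}^n f(t_{n,k})\,\alpha_{n,k}\,p_{n,k}$ with nodes $t_{n,k}\in[a,b]$ and weights $\alpha_{n,k}>0$. For $f_1\in\mathbb{P}_n[a,b]$ strictly increasing on $[a,b]$ (a non-constant increasing polynomial is strictly increasing), $f_1=\sum_{k=0}^n\gamma_{n,k}p_{n,k}$, the operator $B_n^{f_1}$ is the unique (if it exists) generalized Bernstein operator fixing (i.e. mapping to themselves) $\mathbf{1}$ and $f_1$; it has weights $\alpha_{n,k}=1$ and nodes $t_{n,k}=f_1^{-1}(\gamma_{n,k})$, and it exists exactly when all $\gamma_{n,k}\in[f_1(a),f_1(b)]$. $\|\cdot\|_\infty$ is the supremum norm on $[a,b]$. *)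

theory Defs
  imports "HOL-Analysis.Analysis" "HOL-Computational_Algebra.Polynomial"
begin

definition bernstein_basis :: "real \<Rightarrow> real \<Rightarrow> nat \<Rightarrow> nat \<Rightarrow> real \<Rightarrow> real" where
  "bernstein_basis a b n k x =
     real (n choose k) * ((x - a) ^ k * (b - x) ^ (n - k)) / (b - a) ^ n"

text \<open>Operators act on total functions, as do their values: a function on \<open>[a,b]\<close> is represented
  by any extension of it to the reals, and a polynomial by its evaluation. Since the nodes lie in
  \<open>[a,b]\<close>, the image of \<open>f\<close> depends only on the restriction of \<open>f\<close> to \<open>[a,b]\<close>.
  As the formula is imposed for all \<open>f\<close> and all arguments, two operators with the same nodes and
  weights are equal as functions, so that uniqueness of an operator is literal equality.\<close>

definition generalized_bernstein_operator ::
    "real \<Rightarrow> real \<Rightarrow> nat \<Rightarrow> ((real \<Rightarrow> real) \<Rightarrow> real \<Rightarrow> real) \<Rightarrow> bool" where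
  "generalized_bernstein_operator a b n L \<longleftrightarrow>
     (\<exists>t \<alpha> :: nat \<Rightarrow> real.
        (\<forall>k\<le>n. t k \<in> {a..b} \<and> \<alpha> k > 0) \<and>
        L = (\<lambda>f x. \<Sum>k\<le>n. f (t k) * \<alpha> k * bernstein_basis a b n k x))"

definition fixes_on ::
    "real \<Rightarrow> real \<Rightarrow> ((real \<Rightarrow> real) \<Rightarrow> real \<Rightarrow> real) \<Rightarrow> (real \<Rightarrow> real) \<Rightarrow> bool" where
  "fixes_on a b L g \<longleftrightarrow> (\<forall>x\<in>{a..b}. L g x = g x)"

definition is_bernstein_fixing ::
    "real \<Rightarrow> real \<Rightarrow> (real \<Rightarrow> real) \<Rightarrow> nat \<Rightarrow> ((real \<Rightarrow> real) \<Rightarrow> real \<Rightarrow> real) \<Rightarrow> bool" where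
  "is_bernstein_fixing a b f1 n L \<longleftrightarrow>
     generalized_bernstein_operator a b n L \<and> fixes_on a b L (\<lambda>_. 1) \<and> fixes_on a b L f1"

text \<open>Meaningful only for those \<open>n\<close> for which such an operator exists and is unique.\<close>

definition bernstein_fixing ::
    "real \<Rightarrow> real \<Rightarrow> (real \<Rightarrow> real) \<Rightarrow> nat \<Rightarrow> (real \<Rightarrow> real) \<Rightarrow> real \<Rightarrow> real" where
  "bernstein_fixing a b f1 n = (THE L. is_bernstein_fixing a b f1 n L)"

definition sup_norm_on :: "real \<Rightarrow> real \<Rightarrow> (real \<Rightarrow> real) \<Rightarrow> real" where
  "sup_norm_on a b g = (SUP x\<in>{a..b}. \<bar>g x\<bar>)"

end

theory Submission
  imports Defs
begin

text \<open>
  Write \<open>f1 = (\<Sum>k\<le>n. \<gamma>\<^sub>k p\<^sub>k)\<close> in the Bernstein basis of degree \<open>n\<close>. Since that basis is linearly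
  independent and sums to \<open>1\<close>, an operator of generalized Bernstein form fixes \<open>1\<close> and \<open>f1\<close> exactly
  when its weights are \<open>1\<close> and its nodes \<open>t\<^sub>k\<close> satisfy \<open>f1 (t\<^sub>k) = \<gamma>\<^sub>k\<close>
  (\<open>is_bernstein_fixing_iff\<close>). A nonconstant polynomial that is increasing is strictly increasing, so
  such an operator is unique, and it exists as soon as every \<open>\<gamma>\<^sub>k\<close> lies in \<open>[f1 a, f1 b]\<close>
  and \<open>n\<close> is at least the degree of \<open>f1\<close>.

  After an affine change of variable the interval is \<open>[0,1]\<close>. The power \<open>x\<^sup>i\<close> has Bernstein
  coefficients \<open>(k choose i) / (n choose i)\<close>, which differ from \<open>(k / n)\<^sup>i\<close> by at most \<open>i\<^sup>2 / n\<close>; hence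
  for a fixed polynomial \<open>p\<close> the coefficients differ from the values \<open>p (k / n)\<close> by \<open>O(1 / n)\<close>,
  uniformly in \<open>k\<close> (\<open>bernstein_coeff_approx\<close>).

  Uniform closeness alone does not keep the coefficients in the range of \<open>f1\<close> near the endpoints. For
  the lower bound, consider \<open>p = f1 - f1 0\<close>, which is positive on \<open>(0,1]\<close>. Multiplication by \<open>x\<close>
  acts on Bernstein coefficients as an index shift and a nonnegative factor, so the zero of \<open>p\<close> at
  \<open>0\<close> can be divided out; the quotient is positive on all of \<open>[0,1]\<close>, and there the uniform
  approximation gives positive coefficients for large \<open>n\<close> (\<open>eventually_bernstein_coeff_nonneg\<close>).
  The upper bound follows by the reflection \<open>x \<mapsto> 1 - x\<close>.

  For convergence, \<open>f1 (t\<^sub>k)\<close> is uniformly close to the value of \<open>f1\<close> at the \<open>k\<close>-th equidistant node,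
  and \<open>f \<circ> f1\<^sup>-\<^sup>1\<close> is uniformly continuous on the compact range of \<open>f1\<close>. So the operator applied to
  \<open>f\<close> is uniformly close to the classical Bernstein polynomial of \<open>f\<close>, which converges uniformly to
  \<open>f\<close> by Bernstein's theorem (\<open>is_bernstein_fixing_converges\<close>).
\<close>

section \<open>Bernstein coefficients on the unit interval\<close>

text \<open>The \<open>k\<close>-th coefficient of \<open>p\<close> in the Bernstein basis of degree \<open>n\<close> on \<open>[0,1]\<close>, obtained by
  expanding each power of \<open>x\<close>. It has this meaning when \<open>degree p \<le> n\<close>; otherwise the terms with
  \<open>i > n\<close> vanish, being divided by \<open>n choose i = 0\<close>.\<close>

definition bernstein_coeff :: "real poly \<Rightarrow> nat \<Rightarrow> nat \<Rightarrow> real" where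
  "bernstein_coeff p n k =
     (\<Sum>i\<le>degree p. coeff p i * (real (k choose i) / real (n choose i)))"

lemma monomial_eq_Bernstein_sum:
  assumes "i \<le> n"
  shows "(\<Sum>k\<le>n. real (k choose i) / real (n choose i) * Bernstein n k x) = x ^ i"
proof -
  have "(\<Sum>k\<le>n. real (k choose i) / real (n choose i) * Bernstein n k x)
      = (\<Sum>k\<in>{i..n}. real (k choose i) / real (n choose i) * Bernstein n k x)"
    by (rule sum.mono_neutral_right) (auto simp: binomial_eq_0)
  also have "\<dots> = (\<Sum>k\<in>{0+i..(n-i)+i}. real (k choose i) / real (n choose i) * Bernstein n k x)"
    using assms by simp
  also have "\<dots> = (\<Sum>k\<in>{0..n-i}. real ((k+i) choose i) / real (n choose i) * Bernstein n (k+i) x)"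
    by (rule sum.shift_bounds_cl_nat_ivl)
  also have "\<dots> = (\<Sum>k\<in>{0..n-i}. x ^ i * Bernstein (n-i) k x)"
  proof (rule sum.cong)
    fix k assume "k \<in> {0..n-i}"
    then have k: "k + i \<le> n" using assms by auto
    have "(n choose (k+i)) * ((k+i) choose i) = (n choose i) * ((n-i) choose k)"
      using choose_mult[of i "k+i" n] k by simp
    then have "real (n choose (k+i)) * real ((k+i) choose i) = real (n choose i) * real ((n-i) choose k)"
      by (metis of_nat_mult)
    moreover have "real (n choose i) > 0" using assms by simp
    ultimately have "real ((k+i) choose i) / real (n choose i) * real (n choose (k+i)) = real ((n-i) choose k)"
      by (simp add: field_simps)
    moreover have "n - (k + i) = n - i - k" by simp
    ultimately show "real ((k+i) choose i) / real (n choose i) * Bernstein n (k+i) x = x ^ i * Bernstein (n-i) k x"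
      unfolding Bernstein_def by (simp add: power_add mult.assoc[symmetric])
  qed simp
  also have "\<dots> = x ^ i * (\<Sum>k\<le>n-i. Bernstein (n-i) k x)"
    by (simp add: sum_distrib_left atMost_atLeast0)
  finally show ?thesis by simp
qed

lemma poly_eq_Bernstein_sum:
  assumes "degree p \<le> n"
  shows "poly p x = (\<Sum>k\<le>n. bernstein_coeff p n k * Bernstein n k x)"
proof -
  have "(\<Sum>k\<le>n. bernstein_coeff p n k * Bernstein n k x)
     = (\<Sum>k\<le>n. \<Sum>i\<le>degree p. coeff p i * (real (k choose i) / real (n choose i) * Bernstein n k x))"
    by (simp add: bernstein_coeff_def sum_distrib_right mult.assoc)
  also have "\<dots> = (\<Sum>i\<le>degree p. coeff p i * (\<Sum>k\<le>n. real (k choose i) / real (n choose i) * Bernstein n k x))"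
    by (subst sum.swap) (simp add: sum_distrib_left)
  also have "\<dots> = (\<Sum>i\<le>degree p. coeff p i * x ^ i)"
    using assms by (intro sum.cong refl) (subst monomial_eq_Bernstein_sum, simp_all)
  finally show ?thesis by (simp add: poly_altdef)
qed

text \<open>Linear independence of the Bernstein basis: for \<open>u \<ge> 0\<close>, the substitution \<open>x = u / (1 + u)\<close>
  turns a Bernstein sum, up to the factor \<open>(1 + u)\<^sup>n\<close>, into an ordinary polynomial in \<open>u\<close>.\<close>

lemma Bernstein_sum_unique:
  fixes c d :: "nat \<Rightarrow> real"
  assumes eq: "\<And>x. x \<in> {0..1} \<Longrightarrow> (\<Sum>k\<le>n. c k * Bernstein n k x) = (\<Sum>k\<le>n. d k * Bernstein n k x)"
    and "k \<le> n"
  shows "c k = d k"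
proof -
  define e where "e k = (c k - d k) * real (n choose k)" for k
  have "(\<Sum>k\<le>n. e k * u ^ k) = 0" if "u \<ge> 0" for u
  proof -
    have B: "Bernstein n k (u / (1+u)) = real (n choose k) * u ^ k / (1+u) ^ n" if "k \<le> n" for k
    proof -
      have "1 - u / (1+u) = 1 / (1+u)" using \<open>u \<ge> 0\<close> by (simp add: field_simps)
      moreover have "(1+u) ^ n = (1+u) ^ k * (1+u) ^ (n-k)"
        using that by (simp flip: power_add)
      ultimately show ?thesis
        by (simp add: Bernstein_def power_divide)
    qed
    have "(\<Sum>k\<le>n. e k * u ^ k) / (1+u) ^ n = (\<Sum>k\<le>n. (c k - d k) * Bernstein n k (u / (1+u)))"
      unfolding sum_divide_distrib by (rule sum.cong) (simp_all add: B e_def)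
    also have "\<dots> = 0"
      using eq[of "u / (1+u)"] that by (simp add: left_diff_distrib sum_subtractf)
    finally show ?thesis using that by simp
  qed
  then have "{0..1} \<subseteq> {u. (\<Sum>k\<le>n. e k * u ^ k) = 0}" by auto
  then have "infinite {u. (\<Sum>k\<le>n. e k * u ^ k) = 0}"
    by (rule infinite_super) simp
  then have "e k = 0" using polyfun_rootbound[where c = e] \<open>k \<le> n\<close> by blast
  then show ?thesis using \<open>k \<le> n\<close> by (simp add: e_def)
qed

section \<open>Coefficients compared with values\<close>

text \<open>Passing from \<open>i\<close> to \<open>i + 1\<close> multiplies the first quantity by \<open>(k - i) / (n - i)\<close> and the second
  by \<open>k / n\<close>. For \<open>i \<le> k\<close> these factors differ by at most \<open>i / n\<close>, and all quantities lie in
  \<open>[0,1]\<close>; the errors therefore add up to at most \<open>0 + 1 + \<dots> + (i - 1)\<close> over \<open>n\<close>.\<close>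

lemma choose_ratio_approx:
  assumes "k \<le> n" "i \<le> n" "n > 0"
  shows "\<bar>real (k choose i) / real (n choose i) - (real k / real n) ^ i\<bar> \<le> real (i * i) / real n"
  using assms(2)
proof (induction i)
  case (Suc i)
  let ?r = "\<lambda>i. real (k choose i) / real (n choose i)"
  have IH: "\<bar>?r i - (real k / real n) ^ i\<bar> \<le> real (i * i) / real n"
    using Suc by simp
  have q01: "0 \<le> real k / real n" "real k / real n \<le> 1" using assms by auto
  have mono: "real (i * i + i) / real n \<le> real (Suc i * Suc i) / real n"
    by (rule divide_right_mono) auto
  have shrink: "\<bar>y * (real k / real n)\<bar> \<le> \<bar>y\<bar>" for y
    using mult_left_mono[OF q01(2), of "\<bar>y\<bar>"] q01(1) by (simp add: abs_mult)
  show ?case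
  proof (cases "k < i")
    case True
    \<comment> \<open>Here truncated subtraction makes the recursion factor useless, but both ratios vanish.\<close>
    then have "?r (Suc i) = 0" "?r i = 0" by (auto simp: binomial_eq_0)
    moreover have "\<bar>(real k / real n) ^ i * (real k / real n)\<bar> \<le> \<bar>(real k / real n) ^ i\<bar>"
      by (rule shrink)
    moreover have "real (i * i) / real n \<le> real (Suc i * Suc i) / real n"
      by (rule divide_right_mono) auto
    ultimately show ?thesis using IH unfolding power_Suc2 by linarith
  next
    case False
    define s where "s = real (k - i) / real (n - i)"
    have rat: "real (m choose Suc i) * real (Suc i) = real (m choose i) * real (m - i)" for m
    proof -
      have "(m choose Suc i) * Suc i = (m choose i) * (m - i)"
        using binomial_absorption[of i m] binomial_absorb_comp[of m i] by (simp only: mult.commute)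
      then show ?thesis by (simp only: flip: of_nat_mult)
    qed
    have step: "?r (Suc i) = ?r i * s"
    proof -
      have "?r (Suc i) = (real (k choose Suc i) * real (Suc i)) / (real (n choose Suc i) * real (Suc i))"
        by simp
      also have "\<dots> = ?r i * s" unfolding rat s_def by simp
      finally show ?thesis .
    qed
    have r1: "\<bar>?r i\<bar> \<le> 1" using assms Suc.prems by (simp add: binomial_right_mono)
    have ds: "\<bar>s - real k / real n\<bar> \<le> real i / real n"
    proof -
      have *: "real (k - i) = real k - real i" "real (n - i) = real n - real i"
        using False Suc.prems by auto
      have pos: "real n - real i > 0" using Suc.prems by simp
      have e: "s - real k / real n = - ((real i / real n) * ((real n - real k) / (real n - real i)))"
        unfolding s_def * using pos assms(3) by (simp add: field_simps)
      have "(real n - real k) / (real n - real i) \<le> 1" "0 \<le> (real n - real k) / (real n - real i)"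
        using pos False assms by auto
      then show ?thesis unfolding e abs_minus_cancel abs_mult
        using mult_left_mono[of "(real n - real k) / (real n - real i)" 1 "real i / real n"]
        by (simp only: abs_of_nonneg) simp
    qed
    have "?r (Suc i) - (real k / real n) ^ Suc i
        = ?r i * (s - real k / real n) + (?r i - (real k / real n) ^ i) * (real k / real n)"
      unfolding step power_Suc2 left_diff_distrib right_diff_distrib by linarith
    also have "\<bar>\<dots>\<bar> \<le> \<bar>?r i * (s - real k / real n)\<bar> + \<bar>(?r i - (real k / real n) ^ i) * (real k / real n)\<bar>"
      by (rule abs_triangle_ineq)
    also have "\<dots> \<le> real i / real n + real (i * i) / real n"
    proof (rule add_mono)
      show "\<bar>?r i * (s - real k / real n)\<bar> \<le> real i / real n"
        unfolding abs_mult using mult_mono[OF r1 ds] by simp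
      show "\<bar>(?r i - (real k / real n) ^ i) * (real k / real n)\<bar> \<le> real (i * i) / real n"
        using shrink IH by (rule order_trans)
    qed
    also have "\<dots> = real (i * i + i) / real n" by (simp add: add_divide_distrib)
    finally show ?thesis using mono by linarith
  qed
qed simp

lemma bernstein_coeff_approx:
  assumes "e > 0"
  shows "\<forall>\<^sub>F n in sequentially. \<forall>k\<le>n. \<bar>bernstein_coeff p n k - poly p (real k / real n)\<bar> < e"
proof -
  define C where "C = (\<Sum>i\<le>degree p. \<bar>coeff p i\<bar> * real (i * i))"
  have "(\<lambda>n. C / real n) \<longlonglongrightarrow> 0" by (rule lim_const_over_n)
  then have "\<forall>\<^sub>F n in sequentially. C / real n < e" using assms by (rule order_tendstoD)
  moreover have "\<forall>\<^sub>F n in sequentially. n \<ge> max 1 (degree p)" by (rule eventually_ge_at_top)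
  ultimately show ?thesis
  proof eventually_elim
    case (elim n)
    show ?case
    proof (intro allI impI)
      fix k assume "k \<le> n"
      have "\<bar>bernstein_coeff p n k - poly p (real k / real n)\<bar>
         = \<bar>\<Sum>i\<le>degree p. coeff p i * (real (k choose i) / real (n choose i) - (real k / real n) ^ i)\<bar>"
        by (simp add: bernstein_coeff_def poly_altdef sum_subtractf right_diff_distrib)
      also have "\<dots> \<le> (\<Sum>i\<le>degree p. \<bar>coeff p i\<bar> * (real (i * i) / real n))"
        by (rule order_trans[OF sum_abs], rule sum_mono)
           (use elim(2) \<open>k \<le> n\<close> in
             \<open>auto simp: abs_mult simp del: of_nat_mult times_divide_eq_right
               intro!: mult_left_mono choose_ratio_approx\<close>)
      also have "\<dots> = C / real n" by (simp add: C_def sum_divide_distrib)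
      finally show "\<bar>bernstein_coeff p n k - poly p (real k / real n)\<bar> < e" using elim(1) by simp
    qed
  qed
qed

section \<open>Sign and range of the coefficients for large degree\<close>

text \<open>Multiplying a polynomial by \<open>x\<close> shifts its coefficients and rescales them by \<open>k / n\<close>. For
  \<open>k = 0\<close> the factor \<open>k / n\<close> is \<open>0\<close>, so the truncated index \<open>k - 1\<close> does no harm.\<close>

lemma bernstein_coeff_pCons_0:
  "bernstein_coeff (pCons 0 p) n k = real k / real n * bernstein_coeff p (n - 1) (k - 1)"
proof (cases "p = 0")
  case True
  then show ?thesis by (simp add: bernstein_coeff_def)
next
  case False
  have abs: "real (m choose Suc i) * real (Suc i) = real m * real ((m - 1) choose i)" for m i
  proof -
    have "(m choose Suc i) * Suc i = m * ((m - 1) choose i)"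
      using binomial_absorption[of i m] by (simp only: mult.commute)
    then show ?thesis by (simp only: flip: of_nat_mult)
  qed
  have rat: "real (k choose Suc i) / real (n choose Suc i)
      = real k / real n * (real ((k-1) choose i) / real ((n-1) choose i))" for i
  proof -
    have "real (k choose Suc i) / real (n choose Suc i)
        = (real (k choose Suc i) * real (Suc i)) / (real (n choose Suc i) * real (Suc i))" by simp
    then show ?thesis unfolding abs by simp
  qed
  have "bernstein_coeff (pCons 0 p) n k
      = (\<Sum>i\<le>Suc (degree p). coeff (pCons 0 p) i * (real (k choose i) / real (n choose i)))"
    using False by (simp add: bernstein_coeff_def degree_pCons_eq)
  also have "\<dots> = (\<Sum>i\<le>degree p. coeff p i * (real (k choose Suc i) / real (n choose Suc i)))"
    by (subst sum.atMost_Suc_shift) simp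
  finally show ?thesis
    by (simp only: rat bernstein_coeff_def sum_distrib_left mult_ac)
qed

lemma continuous_on_poly_real: "continuous_on A (poly (p :: real poly))"
  by (intro continuous_at_imp_continuous_on ballI poly_isCont)

text \<open>The value at \<open>0\<close> may vanish, to any order. The induction over \<open>pCons\<close> divides out this zero one
  factor \<open>x\<close> at a time, until the polynomial is positive on the whole compact interval.\<close>

lemma eventually_bernstein_coeff_nonneg:
  assumes "\<And>x. 0 < x \<Longrightarrow> x \<le> 1 \<Longrightarrow> poly p x > 0"
  shows "\<forall>\<^sub>F n in sequentially. \<forall>k\<le>n. bernstein_coeff p n k \<ge> 0"
  using assms
proof (induction p)
  case 0
  from 0[of 1] show ?case by simp
next
  case (pCons c p)
  show ?case
  proof (cases "c = 0")
    case True
    have "poly p x > 0" if "0 < x" "x \<le> 1" for x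
      using pCons.prems[OF that] that True by (simp add: zero_less_mult_iff)
    from pCons.IH[OF this]
    obtain N where N: "\<And>n k. n \<ge> N \<Longrightarrow> k \<le> n \<Longrightarrow> bernstein_coeff p n k \<ge> 0"
      by (auto simp: eventually_sequentially)
    have "bernstein_coeff (pCons 0 p) n k \<ge> 0" if "n \<ge> Suc N" "k \<le> n" for n k
      unfolding bernstein_coeff_pCons_0 using that N[of "n - 1" "k - 1"] by simp
    then show ?thesis unfolding eventually_sequentially True by blast
  next
    case False
    let ?q = "pCons c p"
    have "(poly ?q \<longlongrightarrow> poly ?q 0) (at_right 0)"
      using continuous_within_poly[of 0 "{0<..}" ?q] unfolding continuous_within .
    moreover have "\<forall>\<^sub>F x in at_right 0. 0 \<le> poly ?q x"
      using eventually_at_right_less[of 0] eventually_at_right_real[of 0 "1::real"]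
      by (auto elim!: eventually_mono intro!: less_imp_le[OF pCons.prems] simp del: poly_pCons)
    ultimately have "0 \<le> poly ?q 0"
      by (rule tendsto_lowerbound) simp
    then have pos: "poly ?q x > 0" if "x \<in> {0..1}" for x
      using pCons.prems[of x] that False by (cases "x = 0") auto
    \<comment> \<open>The positive minimum of the polynomial is the accuracy demanded of the coefficients.\<close>
    obtain x0 where x0: "x0 \<in> {0..1}" "\<And>x. x \<in> {0..1} \<Longrightarrow> poly ?q x0 \<le> poly ?q x"
      using continuous_attains_inf[OF compact_Icc _ continuous_on_poly_real, of 0 1 ?q] by auto
    have "\<forall>\<^sub>F n in sequentially. \<forall>k\<le>n. \<bar>bernstein_coeff ?q n k - poly ?q (real k / real n)\<bar> < poly ?q x0"
      by (rule bernstein_coeff_approx[OF pos[OF x0(1)]])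
    then show ?thesis
    proof eventually_elim
      case (elim n)
      show ?case
      proof (intro allI impI)
        fix k assume "k \<le> n"
        then have "poly ?q x0 \<le> poly ?q (real k / real n)"
          by (intro x0(2)) (auto simp: divide_le_eq_1)
        then show "bernstein_coeff ?q n k \<ge> 0" using elim \<open>k \<le> n\<close> by (smt (verit))
      qed
    qed
  qed
qed

lemma Bernstein_reflect: "k \<le> n \<Longrightarrow> Bernstein n k (1 - x) = Bernstein n (n - k) x"
  by (simp add: Bernstein_def binomial_symmetric[symmetric] mult_ac)

lemma bernstein_coeff_reflect:
  assumes "degree p \<le> n" "k \<le> n"
  shows "bernstein_coeff (pcompose p [:1, -1:]) n k = bernstein_coeff p n (n - k)"
proof (rule Bernstein_sum_unique[OF _ assms(2)])
  fix x :: real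
  have "(\<Sum>k\<le>n. bernstein_coeff (pcompose p [:1, -1:]) n k * Bernstein n k x) = poly p (1 - x)"
    using poly_eq_Bernstein_sum[of "pcompose p [:1, -1:]" n x] assms(1)
    by (simp add: degree_pcompose poly_pcompose)
  also have "\<dots> = (\<Sum>k\<le>n. bernstein_coeff p n k * Bernstein n (n - k) x)"
    by (simp add: poly_eq_Bernstein_sum[OF assms(1)] Bernstein_reflect)
  also have "\<dots> = (\<Sum>k\<le>n. bernstein_coeff p n (n - k) * Bernstein n k x)"
    by (rule sum.reindex_bij_witness[of _ "\<lambda>k. n - k" "\<lambda>k. n - k"]) auto
  finally show "(\<Sum>k\<le>n. bernstein_coeff (pcompose p [:1, -1:]) n k * Bernstein n k x)
     = (\<Sum>k\<le>n. bernstein_coeff p n (n - k) * Bernstein n k x)" .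
qed

text \<open>If two values coincide, then the polynomial is constant between them, hence everywhere.\<close>

lemma poly_mono_on_imp_strict_mono_on:
  fixes p :: "real poly"
  assumes "mono_on {a..b} (poly p)" "degree p \<ge> 1"
  shows "strict_mono_on {a..b} (poly p)"
proof (rule strict_mono_onI)
  fix x y assume xy: "x \<in> {a..b}" "y \<in> {a..b}" "x < y"
  have "poly p x \<le> poly p y" using assms(1) xy by (auto intro: mono_onD)
  moreover have "poly p x \<noteq> poly p y"
  proof
    assume eq: "poly p x = poly p y"
    have "{x..y} \<subseteq> {z. poly (p - [:poly p x:]) z = 0}"
    proof
      fix z assume z: "z \<in> {x..y}"
      then have "poly p x \<le> poly p z" "poly p z \<le> poly p y"
        using xy by (auto intro!: mono_onD[OF assms(1)])
      then show "z \<in> {z. poly (p - [:poly p x:]) z = 0}" using eq by simp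
    qed
    then have "infinite {z. poly (p - [:poly p x:]) z = 0}"
      using infinite_Icc[OF xy(3)] finite_subset by blast
    then have "p - [:poly p x:] = 0" using poly_roots_finite by blast
    then have "degree p = degree [:poly p x:]" by simp
    then show False using assms(2) by simp
  qed
  ultimately show "poly p x < poly p y" by simp
qed

lemma bernstein_coeff_diff_const:
  shows "bernstein_coeff (p - [:c:]) n k = bernstein_coeff p n k - c"
    and "bernstein_coeff ([:c:] - p) n k = c - bernstein_coeff p n k"
proof -
  have ext: "bernstein_coeff r n k = (\<Sum>i\<le>degree p. coeff r i * (real (k choose i) / real (n choose i)))"
    if "degree r \<le> degree p" for r
    unfolding bernstein_coeff_def using that
    by (intro sum.mono_neutral_left) (auto simp: coeff_eq_0)
  have const: "(\<Sum>i\<le>degree p. coeff [:c:] i * (real (k choose i) / real (n choose i))) = c"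
    by (subst sum.atMost_shift) simp
  have deg: "degree (p - [:c:]) \<le> degree p" "degree ([:c:] - p) \<le> degree p"
    by (auto intro: degree_diff_le)
  show "bernstein_coeff (p - [:c:]) n k = bernstein_coeff p n k - c"
    unfolding ext[OF deg(1)] coeff_diff left_diff_distrib sum_subtractf const
    by (simp add: bernstein_coeff_def)
  show "bernstein_coeff ([:c:] - p) n k = c - bernstein_coeff p n k"
    unfolding ext[OF deg(2)] coeff_diff left_diff_distrib sum_subtractf const
    by (simp add: bernstein_coeff_def)
qed

lemma eventually_bernstein_coeff_in_range:
  assumes "strict_mono_on {0..1} (poly p)"
  shows "\<forall>\<^sub>F n in sequentially. \<forall>k\<le>n. bernstein_coeff p n k \<in> {poly p 0..poly p 1}"
proof -
  let ?r = "[:poly p 1:] - p"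
  have "\<forall>\<^sub>F n in sequentially. \<forall>k\<le>n. bernstein_coeff (p - [:poly p 0:]) n k \<ge> 0"
    by (intro eventually_bernstein_coeff_nonneg)
       (use strict_mono_onD[OF assms, of 0] in auto)
  moreover have "\<forall>\<^sub>F n in sequentially. \<forall>k\<le>n. bernstein_coeff (pcompose ?r [:1, -1:]) n k \<ge> 0"
    by (intro eventually_bernstein_coeff_nonneg)
       (use strict_mono_onD[OF assms, of _ 1] in \<open>auto simp: poly_pcompose\<close>)
  moreover have "\<forall>\<^sub>F n in sequentially. n \<ge> degree ?r" by (rule eventually_ge_at_top)
  ultimately show ?thesis
  proof eventually_elim
    case (elim n)
    show ?case
    proof (intro allI impI)
      fix k assume "k \<le> n"
      have "bernstein_coeff p n k - poly p 0 \<ge> 0"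
        using elim(1) \<open>k \<le> n\<close> by (simp add: bernstein_coeff_diff_const)
      moreover have "poly p 1 - bernstein_coeff p n k \<ge> 0"
        using elim(2)[rule_format, of "n - k"] bernstein_coeff_reflect[OF elim(3), of "n - k"] \<open>k \<le> n\<close>
        by (simp add: bernstein_coeff_diff_const)
      ultimately show "bernstein_coeff p n k \<in> {poly p 0..poly p 1}" by simp
    qed
  qed
qed

section \<open>Transfer to an arbitrary interval\<close>

lemma affine_mem_Icc:
  fixes a b y :: real
  assumes "a < b" "y \<in> {0..1}"
  shows "a + y * (b - a) \<in> {a..b}"
proof -
  have "0 \<le> y * (b - a)" "y * (b - a) \<le> 1 * (b - a)"
    using assms by (intro mult_nonneg_nonneg mult_right_mono; simp)+
  then show ?thesis by simp
qed

lemma bernstein_basis_eq_Bernstein: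
  assumes "a < b" "k \<le> n"
  shows "bernstein_basis a b n k x = Bernstein n k ((x - a) / (b - a))"
proof -
  have "1 - (x - a) / (b - a) = (b - x) / (b - a)" using assms(1) by (simp add: field_simps)
  moreover have "(b - a) ^ n = (b - a) ^ k * (b - a) ^ (n - k)"
    using assms(2) by (simp flip: power_add)
  ultimately show ?thesis by (simp add: bernstein_basis_def Bernstein_def power_divide)
qed

lemma bernstein_basis_sum_unique:
  fixes c d :: "nat \<Rightarrow> real"
  assumes "a < b"
    and eq: "\<And>x. x \<in> {a..b} \<Longrightarrow>
      (\<Sum>k\<le>n. c k * bernstein_basis a b n k x) = (\<Sum>k\<le>n. d k * bernstein_basis a b n k x)"
    and "k \<le> n"
  shows "c k = d k"
proof (rule Bernstein_sum_unique[OF _ assms(3)])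
  fix y :: real assume y: "y \<in> {0..1}"
  have "a + y * (b - a) \<in> {a..b}"
    by (rule affine_mem_Icc[OF assms(1) y])
  from eq[OF this] show "(\<Sum>k\<le>n. c k * Bernstein n k y) = (\<Sum>k\<le>n. d k * Bernstein n k y)"
    using assms(1) by (simp add: bernstein_basis_eq_Bernstein)
qed

text \<open>The coefficients of \<open>p\<close> in the Bernstein basis on \<open>[a,b]\<close>: those on \<open>[0,1]\<close> of
  \<open>p (a + (b - a) y)\<close>.\<close>

definition interval_coeff :: "real \<Rightarrow> real \<Rightarrow> real poly \<Rightarrow> nat \<Rightarrow> nat \<Rightarrow> real" where
  "interval_coeff a b p = bernstein_coeff (pcompose p [:a, b - a:])"

lemma poly_eq_bernstein_basis_sum:
  assumes "a < b" "degree p \<le> n"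
  shows "poly p x = (\<Sum>k\<le>n. interval_coeff a b p n k * bernstein_basis a b n k x)"
proof -
  have "poly p x = poly (pcompose p [:a, b - a:]) ((x - a) / (b - a))"
    using assms(1) by (simp add: poly_pcompose)
  also have "\<dots> = (\<Sum>k\<le>n. interval_coeff a b p n k * Bernstein n k ((x - a) / (b - a)))"
    unfolding interval_coeff_def using assms by (intro poly_eq_Bernstein_sum) (simp add: degree_pcompose)
  finally show ?thesis using assms(1) by (simp add: bernstein_basis_eq_Bernstein)
qed

section \<open>The operator fixing the constants and a polynomial\<close>

lemma sum_bernstein_basis: "a < b \<Longrightarrow> (\<Sum>k\<le>n. bernstein_basis a b n k x) = 1"
  by (simp add: bernstein_basis_eq_Bernstein)

text \<open>The weights of such an operator are forced to be \<open>1\<close>, and its nodes are preimages under \<open>p\<close> of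
  the Bernstein coefficients of \<open>p\<close>.\<close>

lemma is_bernstein_fixing_iff:
  assumes "a < b" "degree p \<le> n"
  shows "is_bernstein_fixing a b (poly p) n L \<longleftrightarrow>
    (\<exists>t. (\<forall>k\<le>n. t k \<in> {a..b} \<and> poly p (t k) = interval_coeff a b p n k) \<and>
         L = (\<lambda>f x. \<Sum>k\<le>n. f (t k) * bernstein_basis a b n k x))"
    (is "_ \<longleftrightarrow> ?R")
proof
  assume "is_bernstein_fixing a b (poly p) n L"
  then obtain t \<alpha> where t: "\<forall>k\<le>n. t k \<in> {a..b} \<and> \<alpha> k > 0"
    and L: "L = (\<lambda>f x. \<Sum>k\<le>n. f (t k) * \<alpha> k * bernstein_basis a b n k x)"
    and one: "\<And>x. x \<in> {a..b} \<Longrightarrow> L (\<lambda>_. 1) x = 1"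
    and fix_p: "\<And>x. x \<in> {a..b} \<Longrightarrow> L (poly p) x = poly p x"
    unfolding is_bernstein_fixing_def generalized_bernstein_operator_def fixes_on_def by blast
  have \<alpha>: "\<alpha> k = 1" if "k \<le> n" for k
    by (rule bernstein_basis_sum_unique[OF assms(1) _ that])
       (use one in \<open>simp add: L sum_bernstein_basis[OF assms(1)]\<close>)
  have L': "L = (\<lambda>f x. \<Sum>k\<le>n. f (t k) * bernstein_basis a b n k x)"
    unfolding L by (intro ext sum.cong) (auto simp: \<alpha>)
  have "poly p (t k) = interval_coeff a b p n k" if "k \<le> n" for k
    by (rule bernstein_basis_sum_unique[OF assms(1) _ that])
       (use fix_p in \<open>simp add: L' flip: poly_eq_bernstein_basis_sum[OF assms]\<close>)
  with t L' show ?R by blast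
next
  assume ?R
  then obtain t where t: "\<forall>k\<le>n. t k \<in> {a..b} \<and> poly p (t k) = interval_coeff a b p n k"
    and L: "L = (\<lambda>f x. \<Sum>k\<le>n. f (t k) * bernstein_basis a b n k x)" by blast
  have "generalized_bernstein_operator a b n L"
    unfolding generalized_bernstein_operator_def
    by (intro exI[of _ t] exI[of _ "\<lambda>_. 1"]) (use t in \<open>simp add: L\<close>)
  moreover have "fixes_on a b L (\<lambda>_. 1)"
    using assms(1) by (simp add: fixes_on_def L sum_bernstein_basis)
  moreover have "L (poly p) x = poly p x" for x
    using t unfolding L poly_eq_bernstein_basis_sum[OF assms, of x] by (intro sum.cong) auto
  ultimately show "is_bernstein_fixing a b (poly p) n L"
    by (simp add: is_bernstein_fixing_def fixes_on_def)
qed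

lemma is_bernstein_fixing_unique:
  assumes "a < b" "degree p \<le> n" "inj_on (poly p) {a..b}"
    and "is_bernstein_fixing a b (poly p) n L" "is_bernstein_fixing a b (poly p) n L'"
  shows "L = L'"
proof -
  from assms(4) obtain t where t: "\<forall>k\<le>n. t k \<in> {a..b} \<and> poly p (t k) = interval_coeff a b p n k"
    and L: "L = (\<lambda>f x. \<Sum>k\<le>n. f (t k) * bernstein_basis a b n k x)"
    unfolding is_bernstein_fixing_iff[OF assms(1,2)] by blast
  from assms(5) obtain s where s: "\<forall>k\<le>n. s k \<in> {a..b} \<and> poly p (s k) = interval_coeff a b p n k"
    and L': "L' = (\<lambda>f x. \<Sum>k\<le>n. f (s k) * bernstein_basis a b n k x)"
    unfolding is_bernstein_fixing_iff[OF assms(1,2)] by blast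
  have "t k = s k" if "k \<le> n" for k
    using inj_onD[OF assms(3), of "t k" "s k"] t s that by simp
  then show ?thesis unfolding L L' by (intro ext sum.cong) auto
qed

lemma is_bernstein_fixing_exists:
  assumes "a < b" "degree p \<le> n"
    and "\<forall>k\<le>n. interval_coeff a b p n k \<in> {poly p a..poly p b}"
  shows "\<exists>L. is_bernstein_fixing a b (poly p) n L"
proof -
  have "\<exists>x. x \<in> {a..b} \<and> poly p x = interval_coeff a b p n k" if "k \<le> n" for k
    using IVT'[of "poly p" a "interval_coeff a b p n k" b] assms(1,3) that
      continuous_on_poly_real[of "{a..b}" p] by auto
  then obtain t where "\<forall>k\<le>n. t k \<in> {a..b} \<and> poly p (t k) = interval_coeff a b p n k"
    by metis
  then show ?thesis unfolding is_bernstein_fixing_iff[OF assms(1,2)] by blast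
qed

section \<open>Uniform convergence\<close>

text \<open>This is the uniform continuity of \<open>f \<circ> g\<^sup>-\<^sup>1\<close> on the compact set \<open>g ` {a..b}\<close>.\<close>

lemma continuous_close_if_inj_image_close:
  fixes f g :: "real \<Rightarrow> real"
  assumes "continuous_on {a..b} f" "continuous_on {a..b} g" "inj_on g {a..b}" "e > 0"
  obtains d where "d > 0"
    "\<And>x y. x \<in> {a..b} \<Longrightarrow> y \<in> {a..b} \<Longrightarrow> \<bar>g x - g y\<bar> < d \<Longrightarrow> \<bar>f x - f y\<bar> < e"
proof -
  let ?h = "\<lambda>z. f (the_inv_into {a..b} g z)"
  have cont: "continuous_on (g ` {a..b}) (the_inv_into {a..b} g)"
    using assms by (intro continuous_on_inv_into) auto
  have "continuous_on (g ` {a..b}) ?h"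
    by (rule continuous_on_compose2[OF assms(1) cont]) (auto simp: the_inv_into_f_f[OF assms(3)])
  moreover have "compact (g ` {a..b})"
    using assms(2) by (intro compact_continuous_image) auto
  ultimately have "uniformly_continuous_on (g ` {a..b}) ?h"
    by (rule compact_uniformly_continuous)
  then obtain d where "d > 0" and d: "\<And>u v. u \<in> g ` {a..b} \<Longrightarrow> v \<in> g ` {a..b} \<Longrightarrow>
      dist v u < d \<Longrightarrow> dist (?h v) (?h u) < e"
    using assms(4) by (rule uniformly_continuous_onE) blast
  have "\<bar>f x - f y\<bar> < e" if "x \<in> {a..b}" "y \<in> {a..b}" "\<bar>g x - g y\<bar> < d" for x y
    using d[of "g y" "g x"] that by (simp add: dist_real_def the_inv_into_f_f[OF assms(3)])
  with \<open>d > 0\<close> show thesis by (rule that)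
qed

text \<open>The bound is split in half between the displacement of the nodes from the equidistant ones and
  the error of the classical Bernstein polynomial.\<close>

lemma is_bernstein_fixing_converges:
  assumes "a < b" "inj_on (poly p) {a..b}" "continuous_on {a..b} f" "e > 0"
  shows "\<forall>\<^sub>F n in sequentially. \<forall>L. is_bernstein_fixing a b (poly p) n L \<longrightarrow>
    (\<forall>x\<in>{a..b}. \<bar>L f x - f x\<bar> < e)"
proof -
  obtain d where "d > 0" and d: "\<And>x y. x \<in> {a..b} \<Longrightarrow> y \<in> {a..b} \<Longrightarrow>
      \<bar>poly p x - poly p y\<bar> < d \<Longrightarrow> \<bar>f x - f y\<bar> < e / 2"
    using continuous_close_if_inj_image_close[OF assms(3) continuous_on_poly_real assms(2)
      half_gt_zero[OF assms(4)]] by blast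
  let ?\<phi> = "\<lambda>y. a + y * (b - a)"
  have \<phi>: "?\<phi> y \<in> {a..b}" if "y \<in> {0..1}" for y
    by (rule affine_mem_Icc[OF assms(1) that])
  have "continuous_on {0..1} (\<lambda>y. f (?\<phi> y))"
    by (rule continuous_on_compose2[OF assms(3)]) (use \<phi> in \<open>auto intro!: continuous_intros\<close>)
  from Bernstein_Weierstrass[OF this, of "e / 2"] assms(4)
  obtain N where N: "\<And>n y. n \<ge> N \<Longrightarrow> y \<in> {0..1} \<Longrightarrow>
      \<bar>f (?\<phi> y) - (\<Sum>k\<le>n. f (?\<phi> (real k / real n)) * Bernstein n k y)\<bar> < e / 2"
    by auto
  have "\<forall>\<^sub>F n in sequentially. \<forall>k\<le>n.
      \<bar>interval_coeff a b p n k - poly (pcompose p [:a, b - a:]) (real k / real n)\<bar> < d"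
    unfolding interval_coeff_def by (rule bernstein_coeff_approx[OF \<open>d > 0\<close>])
  moreover have "\<forall>\<^sub>F n in sequentially. n \<ge> max N (degree p)" by (rule eventually_ge_at_top)
  ultimately show ?thesis
  proof eventually_elim
    case (elim n)
    show ?case
    proof (intro allI impI ballI)
      fix L x assume L: "is_bernstein_fixing a b (poly p) n L" and x: "x \<in> {a..b}"
      from elim(2) have n: "degree p \<le> n" "n \<ge> N" by auto
      obtain t where t: "\<forall>k\<le>n. t k \<in> {a..b} \<and> poly p (t k) = interval_coeff a b p n k"
        and L_eq: "L = (\<lambda>f x. \<Sum>k\<le>n. f (t k) * bernstein_basis a b n k x)"
        using L unfolding is_bernstein_fixing_iff[OF assms(1) n(1)] by blast
      define y where "y = (x - a) / (b - a)"
      have y: "y \<in> {0..1}" "?\<phi> y = x" using x assms(1) by (auto simp: y_def)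
      have close: "\<bar>f (t k) - f (?\<phi> (real k / real n))\<bar> \<le> e / 2" if "k \<le> n" for k
      proof (rule less_imp_le, rule d)
        show "?\<phi> (real k / real n) \<in> {a..b}" using that by (intro \<phi>) (auto simp: divide_le_eq_1)
        show "\<bar>poly p (t k) - poly p (?\<phi> (real k / real n))\<bar> < d"
          using elim(1) t that by (simp add: poly_pcompose)
      qed (use t that in auto)
      have Lx: "L f x = (\<Sum>k\<le>n. f (t k) * Bernstein n k y)"
        unfolding L_eq y_def using assms(1) by (simp add: bernstein_basis_eq_Bernstein)
      have "\<bar>L f x - (\<Sum>k\<le>n. f (?\<phi> (real k / real n)) * Bernstein n k y)\<bar>
          = \<bar>\<Sum>k\<le>n. (f (t k) - f (?\<phi> (real k / real n))) * Bernstein n k y\<bar>"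
        unfolding Lx by (simp add: left_diff_distrib sum_subtractf)
      also have "\<dots> \<le> (\<Sum>k\<le>n. e / 2 * Bernstein n k y)"
        by (rule order_trans[OF sum_abs], rule sum_mono)
           (use y(1) close in \<open>simp add: abs_mult Bernstein_nonneg mult_right_mono
             del: times_divide_eq_left times_divide_eq_right\<close>)
      also have "\<dots> = e / 2" unfolding sum_distrib_left[symmetric] by simp
      finally show "\<bar>L f x - f x\<bar> < e" using N[OF n(2) y(1)] unfolding y(2) by linarith
    qed
  qed
qed

lemma sup_norm_on_bounds:
  assumes "a \<le> b" "\<And>x. x \<in> {a..b} \<Longrightarrow> \<bar>g x\<bar> \<le> e"
  shows "0 \<le> sup_norm_on a b g" "sup_norm_on a b g \<le> e"
proof -
  have "\<bar>g a\<bar> \<le> sup_norm_on a b g"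
    unfolding sup_norm_on_def using assms by (intro cSUP_upper bdd_aboveI2[of _ _ e]) auto
  then show "0 \<le> sup_norm_on a b g" by linarith
  show "sup_norm_on a b g \<le> e"
    unfolding sup_norm_on_def using assms by (intro cSUP_least) auto
qed

theorem theorem6p11:
  fixes a b :: real and m :: nat and f1 :: "real poly"
  assumes "a < b"
    and "degree f1 = m" and "m \<ge> 1"
    and "mono_on {a..b} (poly f1)"
  shows "(\<forall>\<^sub>F n in sequentially. \<exists>!L. is_bernstein_fixing a b (poly f1) n L) \<and>
    (\<forall>f :: real \<Rightarrow> real. continuous_on {a..b} f \<longrightarrow>
      (\<lambda>n. sup_norm_on a b (\<lambda>x. bernstein_fixing a b (poly f1) n f x - f x)) \<longlonglongrightarrow> 0)"
proof -
  have strict: "strict_mono_on {a..b} (poly f1)"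
    using assms by (intro poly_mono_on_imp_strict_mono_on) auto
  then have inj: "inj_on (poly f1) {a..b}" by (rule strict_mono_on_imp_inj_on)
  have "strict_mono_on {0..1} (poly (pcompose f1 [:a, b - a:]))"
  proof (rule strict_mono_onI)
    fix x y :: real assume xy: "x \<in> {0..1}" "y \<in> {0..1}" "x < y"
    have "a + z * (b - a) \<in> {a..b}" if "z \<in> {0..1}" for z
      by (rule affine_mem_Icc[OF assms(1) that])
    moreover have "a + x * (b - a) < a + y * (b - a)" using xy(3) assms(1) by simp
    ultimately show "poly (pcompose f1 [:a, b - a:]) x < poly (pcompose f1 [:a, b - a:]) y"
      using strict_mono_onD[OF strict] xy by (simp add: poly_pcompose)
  qed
  from eventually_bernstein_coeff_in_range[OF this]
  have "\<forall>\<^sub>F n in sequentially. \<forall>k\<le>n. interval_coeff a b f1 n k \<in> {poly f1 a..poly f1 b}"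
    by (simp add: interval_coeff_def poly_pcompose)
  then have ex1: "\<forall>\<^sub>F n in sequentially. \<exists>!L. is_bernstein_fixing a b (poly f1) n L"
    using eventually_ge_at_top[of m]
  proof eventually_elim
    case (elim n)
    then show ?case
      using is_bernstein_fixing_exists[of a b f1 n] is_bernstein_fixing_unique[of a b f1 n] inj assms(1,2)
      by blast
  qed
  have "(\<lambda>n. sup_norm_on a b (\<lambda>x. bernstein_fixing a b (poly f1) n f x - f x)) \<longlonglongrightarrow> 0"
    if f: "continuous_on {a..b} f" for f
  proof (rule tendstoI)
    fix e :: real assume "e > 0"
    then have "e / 2 > 0" by simp
    from ex1 is_bernstein_fixing_converges[OF assms(1) inj f this]
    show "\<forall>\<^sub>F n in sequentially.
        dist (sup_norm_on a b (\<lambda>x. bernstein_fixing a b (poly f1) n f x - f x)) 0 < e"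
    proof eventually_elim
      case (elim n)
      have "is_bernstein_fixing a b (poly f1) n (bernstein_fixing a b (poly f1) n)"
        unfolding bernstein_fixing_def by (rule theI'[OF elim(1)])
      with elim(2) have bound: "\<And>x. x \<in> {a..b} \<Longrightarrow>
          \<bar>bernstein_fixing a b (poly f1) n f x - f x\<bar> \<le> e / 2"
        by (blast intro: less_imp_le)
      let ?g = "\<lambda>x. bernstein_fixing a b (poly f1) n f x - f x"
      have "0 \<le> sup_norm_on a b ?g" "sup_norm_on a b ?g \<le> e / 2"
        using sup_norm_on_bounds[of a b ?g "e / 2"] bound assms(1) by auto
      then show ?case using \<open>e > 0\<close> unfolding dist_real_def by linarith
    qed
  qed
  with ex1 show ?thesis by blast
qed

end
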